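(* Let $G=(V,E,\mathbf{w},\boldsymbol{\mu})$ be a submodular hypergraph, and consider the optimization problem solved in each iteration $k$ (Step 3) of the inverse power method (Algorithm 2) described in the context: $$(\ast)\qquad \min_{z:\ \|z\|\le1}\ Q_1(z)-\hat\lambda^k\langle z,g^k\rangle .$$ 1) If the norm of the vector $z$ in $(\ast)$ is $\|z\|_2$, then $(\ast)$ is the dual of the $\ell_2$ minimization problem $$\min_{y_e}\ \Big\|\sum_{e\in E}y_e-\hat\lambda^kg^k\Big\|_2^2,\qquad y_e\in\vartheta_e\mathcal{B}_e\ \ \forall e\in E,$$ where the primal and dual variables are related according to $$z=\frac{\hat\lambda^kg^k-\sum_{e\in E}y_e}{\big\|\hat\lambda^kg^k-\sum_{e\in E}y_e\big\|_2}.$$ 2) If the norm of the vector $z$ in $(\ast)$ is $\|z\|_\infty$, then $(\ast)$ is equivalent to the submodular function minimization problem $$\min_{S\subseteq V}\ \sum_{e\in E}\vartheta_ew_e(S)-\hat\lambda^kg^k(S),$$ where the primal and dual variables are related according to $z_v=1$ if $v\in S$ and $z_v=-1$ if $v\notin S$.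
   Context: Submodular hypergraph: $V=[N]=\{1,\dots,N\}$; $E\subseteq 2^V$ is a set of hyperedges; each vertex has a weight $\mu_v>0$; each $e\in E$ carries a scalar $\vartheta_e>0$ and a function $w_e:2^e\to[0,1]$ that is submodular ($w_e(S)+w_e(T)\ge w_e(S\cup T)+w_e(S\cap T)$), satisfies $w_e(\emptyset)=0$, is symmetric ($w_e(S)=w_e(e\setminus S)$), and is normalized (the original cut weights of $e$ are divided by their maximum $\vartheta_e$, so that $\max_{S\subseteq e}w_e(S)=1$); $v\in e$ if and only if $w_e(\{v\})>0$. For $S\subseteq V$ put $w_e(S):=w_e(S\cap e)$. Lovász extension: for $y\in\mathbb{R}^N$, $y(S)=\sum_{v\in S}y_v$ (likewise $g^k(S)=\sum_{v\in S}g^k_v$); $\mathcal{B}_e=\{y\in\mathbb{R}^N: y(S)\le w_e(S)\ \forall S\subseteq V,\ y(V)=0\}$; $f_e(x)=\max_{y\in\mathcal{B}_e}\langle y,x\rangle$. $Q_1(x)=\sum_{e\in E}\vartheta_e f_e(x)$; $\|x\|_{\ell_1,\mu}=\sum_v\mu_v|x_v|$; $\mathcal{R}_1(x)=Q_1(x)/\min_{c\in\mathbb{R}}\|x-c\mathbf{1}\|_{\ell_1,\mu}$. $\mu_1^+(x)=\sum_{v:x_v>0}\mu_v$, $\mu_1^-(x)=\sum_{v:x_v<0}\mu_v$, $\mu^0(x)=\sum_{v:x_v=0}\mu_v$. Algorithm 2 (inverse power method; $\|\cdot\|$ is a norm on $\mathbb{R}^N$): find a nonconstant $x^0\in\mathbb{R}^N$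 such that $0\in\arg\min_c\|x^0-c\mathbf{1}\|_{\ell_1,\mu}$, and initialize $\hat\lambda^0=\mathcal{R}_1(x^0)$, $k=0$. Repeat: for each $v\in V$ set $g^k_v=\mathrm{sgn}(x^k_v)\mu_v$ if $x^k_v\ne0$, and $g^k_v=-\frac{\mu_1^+(x^k)-\mu_1^-(x^k)}{\mu^0(x^k)}\mu_v$ if $x^k_v=0$; let $z^{k+1}$ be a solution of $(\ast)$; $c^{k+1}\leftarrow\arg\min_c\|z^{k+1}-c\mathbf{1}\|_{\ell_1,\mu}$; $x^{k+1}\leftarrow z^{k+1}-c^{k+1}\mathbf{1}$; $\hat\lambda^{k+1}\leftarrow\mathcal{R}_1(x^{k+1})$; until $|\hat\lambda^{k+1}-\hat\lambda^k|/\hat\lambda^k<\epsilon$. *)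

theory Defs
  imports "HOL-Analysis.Analysis"
begin

section \<open>Submodular hypergraphs\<close>

text \<open>
  The vertex set is the whole finite type \<open>'n\<close>, so a vector indexed by the vertices is an element
  of \<open>real ^ 'n\<close>.  Only the values \<open>w e S\<close> with \<open>S \<subseteq> e\<close> are meaningful; the convention
  \<open>w\<^sub>e(S) := w\<^sub>e(S \<inter> e)\<close> for arbitrary \<open>S\<close> is \<open>cut_weight\<close>.
\<close>

definition cut_weight :: "('n set \<Rightarrow> 'n set \<Rightarrow> real) \<Rightarrow> 'n set \<Rightarrow> 'n set \<Rightarrow> real" where
  "cut_weight w e S = w e (S \<inter> e)"

locale submodular_hypergraph =
  fixes E :: "'n::finite set set"
    and w :: "'n set \<Rightarrow> 'n set \<Rightarrow> real"
    and \<theta> :: "'n set \<Rightarrow> real"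
    and \<mu> :: "'n \<Rightarrow> real"
  assumes vertex_weight_pos: "\<And>v. \<mu> v > 0"
    and edge_weight_pos: "\<And>e. e \<in> E \<Longrightarrow> \<theta> e > 0"
    and weight_range: "\<And>e S. e \<in> E \<Longrightarrow> S \<subseteq> e \<Longrightarrow> w e S \<in> {0..1}"
    and submodular: "\<And>e S T. e \<in> E \<Longrightarrow> S \<subseteq> e \<Longrightarrow> T \<subseteq> e \<Longrightarrow>
                       w e S + w e T \<ge> w e (S \<union> T) + w e (S \<inter> T)"
    and weight_empty: "\<And>e. e \<in> E \<Longrightarrow> w e {} = 0"
    and symmetric: "\<And>e S. e \<in> E \<Longrightarrow> S \<subseteq> e \<Longrightarrow> w e S = w e (e - S)"
    and normalized: "\<And>e. e \<in> E \<Longrightarrow> Max (w e ` Pow e) = 1"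
    and incident: "\<And>e v. e \<in> E \<Longrightarrow> v \<in> e \<longleftrightarrow> cut_weight w e {v} > 0"

definition base_polytope :: "('n::finite set \<Rightarrow> 'n set \<Rightarrow> real) \<Rightarrow> 'n set \<Rightarrow> (real ^ 'n) set" where
  "base_polytope w e =
     {y. (\<forall>S. (\<Sum>v\<in>S. y $ v) \<le> cut_weight w e S) \<and> (\<Sum>v\<in>UNIV. y $ v) = 0}"

definition lovasz_ext :: "('n::finite set \<Rightarrow> 'n set \<Rightarrow> real) \<Rightarrow> 'n set \<Rightarrow> real ^ 'n \<Rightarrow> real" where
  "lovasz_ext w e x = (SUP y\<in>base_polytope w e. y \<bullet> x)"

definition Q1 ::
  "'n::finite set set \<Rightarrow> ('n set \<Rightarrow> 'n set \<Rightarrow> real) \<Rightarrow> ('n set \<Rightarrow> real) \<Rightarrow> real ^ 'n \<Rightarrow> real" where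
  "Q1 E w \<theta> x = (\<Sum>e\<in>E. \<theta> e * lovasz_ext w e x)"

definition l1_norm :: "('n::finite \<Rightarrow> real) \<Rightarrow> real ^ 'n \<Rightarrow> real" where
  "l1_norm \<mu> x = (\<Sum>v\<in>UNIV. \<mu> v * \<bar>x $ v\<bar>)"

definition R1 ::
  "'n::finite set set \<Rightarrow> ('n set \<Rightarrow> 'n set \<Rightarrow> real) \<Rightarrow> ('n set \<Rightarrow> real) \<Rightarrow> ('n \<Rightarrow> real) \<Rightarrow>
   real ^ 'n \<Rightarrow> real" where
  "R1 E w \<theta> \<mu> x = Q1 E w \<theta> x / (INF c. l1_norm \<mu> (x - vec c))"

section \<open>The inverse power method\<close>

definition mu_plus :: "('n::finite \<Rightarrow> real) \<Rightarrow> real ^ 'n \<Rightarrow> real" where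
  "mu_plus \<mu> x = (\<Sum>v\<in>{v. x $ v > 0}. \<mu> v)"

definition mu_minus :: "('n::finite \<Rightarrow> real) \<Rightarrow> real ^ 'n \<Rightarrow> real" where
  "mu_minus \<mu> x = (\<Sum>v\<in>{v. x $ v < 0}. \<mu> v)"

definition mu_zero :: "('n::finite \<Rightarrow> real) \<Rightarrow> real ^ 'n \<Rightarrow> real" where
  "mu_zero \<mu> x = (\<Sum>v\<in>{v. x $ v = 0}. \<mu> v)"

definition ipm_g :: "('n::finite \<Rightarrow> real) \<Rightarrow> real ^ 'n \<Rightarrow> real ^ 'n" where
  "ipm_g \<mu> x = (\<chi> v. if x $ v \<noteq> 0 then sgn (x $ v) * \<mu> v
                      else - ((mu_plus \<mu> x - mu_minus \<mu> x) / mu_zero \<mu> x) * \<mu> v)"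

definition ipm_objective ::
  "'n::finite set set \<Rightarrow> ('n set \<Rightarrow> 'n set \<Rightarrow> real) \<Rightarrow> ('n set \<Rightarrow> real) \<Rightarrow> real \<Rightarrow> real ^ 'n \<Rightarrow>
   real ^ 'n \<Rightarrow> real" where
  "ipm_objective E w \<theta> lam g z = Q1 E w \<theta> z - lam * (z \<bullet> g)"

text \<open>
  \<open>ipm_state E w \<theta> \<mu> nrm \<epsilon> k x lam\<close> says that some run of the algorithm with the norm \<open>nrm\<close> and
  the tolerance \<open>\<epsilon>\<close> (there are several runs, since the initial vector and the minimisers are not
  unique) enters iteration \<open>k\<close> with \<open>x\<close> and \<open>lam\<close> as current iterate and eigenvalue estimate; in
  particular the stopping test has failed after each earlier iteration.  When the minimum over
  \<open>nrm z \<le> 1\<close> is 0, the solution \<open>z\<close> may be constant; the next estimate is then 0 by \<open>x / 0 = 0\<close>.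
\<close>

inductive ipm_state ::
  "'n::finite set set \<Rightarrow> ('n set \<Rightarrow> 'n set \<Rightarrow> real) \<Rightarrow> ('n set \<Rightarrow> real) \<Rightarrow> ('n \<Rightarrow> real) \<Rightarrow>
   (real ^ 'n \<Rightarrow> real) \<Rightarrow> real \<Rightarrow> nat \<Rightarrow> real ^ 'n \<Rightarrow> real \<Rightarrow> bool"
  for E w \<theta> \<mu> nrm \<epsilon> where
  init: "ipm_state E w \<theta> \<mu> nrm \<epsilon> 0 x (R1 E w \<theta> \<mu> x)"
    if "\<nexists>c. x = vec c"
      and "is_arg_min (\<lambda>c. l1_norm \<mu> (x - vec c)) (\<lambda>_. True) 0"
| step: "ipm_state E w \<theta> \<mu> nrm \<epsilon> (Suc k) x' lam'"
    if "ipm_state E w \<theta> \<mu> nrm \<epsilon> k x lam"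
      and "is_arg_min (ipm_objective E w \<theta> lam (ipm_g \<mu> x)) (\<lambda>z. nrm z \<le> 1) z"
      and "is_arg_min (\<lambda>c. l1_norm \<mu> (z - vec c)) (\<lambda>_. True) c"
      and "x' = z - vec c"
      and "lam' = R1 E w \<theta> \<mu> x'"
      and "\<not> \<bar>lam' - lam\<bar> / lam < \<epsilon>"

section \<open>Duality\<close>

text \<open>
  Lagrangian (minimax) duality with respect to the coupling function \<open>L\<close>: the primal problem is to
  minimise \<open>P y = max\<^sub>z L y z\<close> over \<open>Y\<close>, the dual problem is to maximise \<open>D z = min\<^sub>y L y z\<close>
  over \<open>Z\<close>; both are solvable and there is no duality gap.
\<close>

definition minimax_dual ::
  "('a \<Rightarrow> 'b \<Rightarrow> real) \<Rightarrow> 'a set \<Rightarrow> ('a \<Rightarrow> real) \<Rightarrow> 'b set \<Rightarrow> ('b \<Rightarrow> real) \<Rightarrow> bool" where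
  "minimax_dual L Y P Z D \<longleftrightarrow>
     (\<forall>y\<in>Y. \<exists>z. is_arg_max (L y) (\<lambda>z. z \<in> Z) z \<and> P y = L y z) \<and>
     (\<forall>z\<in>Z. \<exists>y. is_arg_min (\<lambda>y. L y z) (\<lambda>y. y \<in> Y) y \<and> D z = L y z) \<and>
     (\<exists>y z. is_arg_min P (\<lambda>y. y \<in> Y) y \<and> is_arg_max D (\<lambda>z. z \<in> Z) z \<and> P y = D z)"

definition l2_feasible ::
  "'n::finite set set \<Rightarrow> ('n set \<Rightarrow> 'n set \<Rightarrow> real) \<Rightarrow> ('n set \<Rightarrow> real) \<Rightarrow>
   ('n set \<Rightarrow> real ^ 'n) set" where
  "l2_feasible E w \<theta> = {y. \<forall>e\<in>E. y e \<in> (\<lambda>b. \<theta> e *\<^sub>R b) ` base_polytope w e}"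

definition l2_objective ::
  "'n::finite set set \<Rightarrow> real \<Rightarrow> real ^ 'n \<Rightarrow> ('n set \<Rightarrow> real ^ 'n) \<Rightarrow> real" where
  "l2_objective E lam g y = (norm ((\<Sum>e\<in>E. y e) - lam *\<^sub>R g))\<^sup>2"

definition sfm_objective ::
  "'n::finite set set \<Rightarrow> ('n set \<Rightarrow> 'n set \<Rightarrow> real) \<Rightarrow> ('n set \<Rightarrow> real) \<Rightarrow> real \<Rightarrow> real ^ 'n \<Rightarrow>
   'n set \<Rightarrow> real" where
  "sfm_objective E w \<theta> lam g S = (\<Sum>e\<in>E. \<theta> e * cut_weight w e S) - lam * (\<Sum>v\<in>S. g $ v)"

definition sign_vector :: "'n::finite set \<Rightarrow> real ^ 'n" where
  "sign_vector S = (\<chi> v. if v \<in> S then 1 else - 1)"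

end

theory Submission
  imports Defs "HOL-Library.Set_Algebras"
begin

text \<open>
  The Lovasz extension is the support function of the base polytope, so \<open>Q1\<close> is the support
  function of the Minkowski sum \<open>K\<close> of the polytopes \<open>\<theta> e B\<^sub>e\<close>. For the Euclidean norm the
  residual \<open>r\<close> of the projection of \<open>\<lambda>g\<close> onto \<open>K\<close> is normal to \<open>K\<close> at the projection; this
  yields a saddle point of the coupling, and the equality case of Cauchy--Schwarz gives uniqueness.
  For the maximum norm, Edmonds' greedy algorithm, run along the vertices sorted by decreasing
  \<open>z\<close>, bounds the objective at \<open>z\<close> from below by a nonnegative combination, of total weight at
  most 2, of values of the set function at prefixes of the order. Here the set function vanishes
  on the whole vertex set because the entries of \<open>g\<close> sum to 0, which is the optimality condition
  for the weighted median 0 of the current iterate.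
\<close>

section \<open>The greedy algorithm\<close>

text \<open>Each new element receives its marginal gain over the elements before it, so sums over
  prefixes telescope to \<open>F\<close>. The inequality for \<open>T\<close> follows by diminishing
  returns: the gain of the last element over all its predecessors is at most its gain over the rest
  of \<open>T\<close>.\<close>

lemma greedy_vector_exists:
  fixes F :: "'a set \<Rightarrow> real"
  assumes "distinct xs" and "F {} = 0"
    and submod: "\<And>S T. F (S \<union> T) + F (S \<inter> T) \<le> F S + F T"
  shows "\<exists>y. (\<forall>ys zs. xs = ys @ zs \<longrightarrow> sum y (set ys) = F (set ys)) \<and>
             (\<forall>T\<subseteq>set xs. sum y T \<le> F T)"
  using assms(1)
proof (induction xs rule: rev_induct)
  case Nil
  then show ?case using assms(2) by auto
next
  case (snoc a xs)
  let ?A = "set xs"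
  obtain y where tight: "\<And>ys zs. xs = ys @ zs \<Longrightarrow> sum y (set ys) = F (set ys)"
    and le: "\<And>T. T \<subseteq> ?A \<Longrightarrow> sum y T \<le> F T"
    using snoc by fastforce
  have a: "a \<notin> ?A" using snoc.prems by simp
  define y' where "y' = y(a := F (insert a ?A) - F ?A)"
  have y': "sum y' T = sum y T" if "T \<subseteq> ?A" for T
    using that a by (intro sum.cong) (auto simp: y'_def)
  have ins: "sum y' (insert a T) = sum y T + F (insert a ?A) - F ?A" if "T \<subseteq> ?A" for T
  proof -
    have "finite T" "a \<notin> T" using that a finite_subset by auto
    then show ?thesis using y'[OF that] by (simp add: y'_def)
  qed
  have "sum y' (set ys) = F (set ys)" if "xs @ [a] = ys @ zs" for ys zs
  proof (cases zs rule: rev_cases)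
    case Nil
    then have "set ys = insert a ?A" using that by auto
    then show ?thesis using ins[of ?A] tight[of xs "[]"] by simp
  next
    case (snoc zs' b)
    then have "xs = ys @ zs'" using that by simp
    then show ?thesis using tight y' by auto
  qed
  moreover have "sum y' T \<le> F T" if T: "T \<subseteq> set (xs @ [a])" for T
  proof (cases "a \<in> T")
    case False
    then have "T \<subseteq> ?A" using T by auto
    then show ?thesis using y' le by simp
  next
    case True
    let ?T = "T - {a}"
    have sub: "?T \<subseteq> ?A" using T by auto
    \<comment> \<open>Submodularity at \<open>T\<close> and \<open>?A\<close> compares the gain of
      \<open>a\<close> over \<open>?A\<close> with its gain over \<open>T - {a}\<close>.\<close>
    have "T \<union> ?A = insert a ?A" "T \<inter> ?A = ?T" using T True a by auto
    then have "F (insert a ?A) + F ?T \<le> F T + F ?A" using submod[of T ?A] by simp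
    moreover have "sum y' T = sum y ?T + F (insert a ?A) - F ?A"
      using ins[OF sub] True by (simp add: insert_absorb)
    ultimately show ?thesis using le[OF sub] by simp
  qed
  ultimately show ?case by blast
qed

text \<open>Summation by parts along a decreasing order.\<close>

lemma sum_mult_ge_of_prefix_sums_ge:
  fixes y z :: "'a \<Rightarrow> real"
  assumes "distinct xs" and "sorted_wrt (\<lambda>u v. z v \<le> z u) xs"
    and "\<And>ys zs. xs = ys @ zs \<Longrightarrow> m \<le> sum y (set ys)"
    and "\<And>v. v \<in> set xs \<Longrightarrow> t \<le> z v" and "\<And>v. v \<in> set xs \<Longrightarrow> z v \<le> s" and "t \<le> s"
  shows "m * (s - t) \<le> (\<Sum>v\<in>set xs. y v * (z v - t))"
  using assms
proof (induction xs arbitrary: t rule: rev_induct)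
  case Nil
  \<comment> \<open>The empty prefix counts too: it forces \<open>m \<le> 0\<close>.\<close>
  from Nil(3)[of "[]" "[]"] have "m \<le> 0" by simp
  then show ?case using Nil by (simp add: mult_nonpos_nonneg)
next
  case (snoc a xs)
  have a: "a \<notin> set xs" using snoc.prems(1) by simp
  \<comment> \<open>The threshold is raised from \<open>t\<close> to \<open>z a\<close>, the least
    value along the list. The difference is the sum of \<open>y\<close> over the whole list times
    \<open>z a - t\<close>, and the whole list is itself a prefix.\<close>
  have IH: "m * (s - z a) \<le> (\<Sum>v\<in>set xs. y v * (z v - z a))"
  proof (rule snoc.IH)
    show "m \<le> sum y (set ys)" if "xs = ys @ zs" for ys zs
      using snoc.prems(3)[of ys "zs @ [a]"] that by simp
  qed (use snoc.prems in \<open>auto simp: sorted_wrt_append\<close>)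
  have "m \<le> sum y (set xs) + y a"
    using snoc.prems(3)[of "xs @ [a]" "[]"] a by simp
  moreover have "t \<le> z a" using snoc.prems(4) by simp
  ultimately have "m * (z a - t) \<le> (sum y (set xs) + y a) * (z a - t)"
    by (intro mult_right_mono) auto
  moreover have "(\<Sum>v\<in>set (xs @ [a]). y v * (z v - t)) =
      (\<Sum>v\<in>set xs. y v * (z v - z a)) + (sum y (set xs) + y a) * (z a - t)"
    using a by (simp add: algebra_simps sum.distrib sum_subtractf sum_distrib_left sum_distrib_right)
  ultimately show ?case using IH by (simp add: algebra_simps)
qed

section \<open>Base polytopes\<close>

context submodular_hypergraph
begin

lemma cut_weight_submodular:
  assumes "e \<in> E"
  shows "cut_weight w e (S \<union> T) + cut_weight w e (S \<inter> T) \<le> cut_weight w e S + cut_weight w e T"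
proof -
  have "(S \<union> T) \<inter> e = (S \<inter> e) \<union> (T \<inter> e)" "(S \<inter> T) \<inter> e = (S \<inter> e) \<inter> (T \<inter> e)" by auto
  then show ?thesis unfolding cut_weight_def using submodular[OF assms, of "S \<inter> e" "T \<inter> e"] by simp
qed

lemma cut_weight_empty: "e \<in> E \<Longrightarrow> cut_weight w e {} = 0"
  by (simp add: cut_weight_def weight_empty)

lemma cut_weight_UNIV: "e \<in> E \<Longrightarrow> cut_weight w e UNIV = 0"
  using symmetric[of e e] by (simp add: cut_weight_def weight_empty)

lemma cut_weight_range: "e \<in> E \<Longrightarrow> cut_weight w e S \<in> {0..1}"
  unfolding cut_weight_def by (rule weight_range) auto

lemma zero_in_base_polytope: "e \<in> E \<Longrightarrow> 0 \<in> base_polytope w e"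
  using cut_weight_range by (auto simp: base_polytope_def)

lemma compact_base_polytope:
  assumes "e \<in> E"
  shows "compact (base_polytope w e)"
proof -
  have "closed {y :: real ^ 'n. (\<forall>S. (\<Sum>v\<in>S. y $ v) \<le> cut_weight w e S) \<and> (\<Sum>v\<in>UNIV. y $ v) = 0}"
    by (intro closed_Collect_conj closed_Collect_all closed_Collect_le closed_Collect_eq
        continuous_intros)
  moreover have "bounded (base_polytope w e)"
  proof (rule boundedI)
    fix y assume y: "y \<in> base_polytope w e"
    have le: "(\<Sum>v\<in>S. y $ v) \<le> 1" for S
      using y cut_weight_range[OF assms, of S]
      by (force simp: base_polytope_def intro: order_trans)
    have "\<bar>y $ i\<bar> \<le> 1" for i
    proof -
      \<comment> \<open>Since the entries sum to 0, the constraint for the complement of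
        \<open>{i}\<close> bounds \<open>y $ i\<close> from below.\<close>
      have "y $ i + (\<Sum>v\<in>- {i}. y $ v) = 0"
        using y sum.subset_diff[of "{i}" UNIV "\<lambda>v. y $ v"]
        by (simp add: base_polytope_def Compl_eq_Diff_UNIV)
      then show ?thesis using le[of "{i}"] le[of "- {i}"] by simp
    qed
    then have "(\<Sum>i\<in>UNIV. \<bar>y $ i\<bar>) \<le> real CARD('n) * 1" by (intro sum_bounded_above)
    then show "norm y \<le> real CARD('n)" using norm_le_l1_cart[of y] by simp
  qed
  ultimately show ?thesis by (simp add: compact_eq_bounded_closed base_polytope_def)
qed

lemma convex_base_polytope: "convex (base_polytope w e)"
proof (rule convexI)
  fix x y :: "real ^ 'n" and u v :: real
  assume x: "x \<in> base_polytope w e" and y: "y \<in> base_polytope w e"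
    and uv: "0 \<le> u" "0 \<le> v" "u + v = 1"
  have "u * (\<Sum>i\<in>S. x $ i) + v * (\<Sum>i\<in>S. y $ i) \<le> cut_weight w e S" for S
    using x y uv by (intro convex_bound_le) (auto simp: base_polytope_def)
  then show "u *\<^sub>R x + v *\<^sub>R y \<in> base_polytope w e"
    using x y by (simp add: base_polytope_def sum.distrib sum_distrib_left[symmetric])
qed

text \<open>The list runs through all vertices, so the vertex set is its last prefix. The cut weight
  vanishes there by symmetry, which makes the entries of the greedy vector sum to 0.\<close>

lemma greedy_in_base_polytope:
  assumes "e \<in> E" and "distinct xs" and "set xs = UNIV"
  shows "\<exists>y\<in>base_polytope w e. \<forall>ys zs. xs = ys @ zs \<longrightarrow>
           (\<Sum>v\<in>set ys. y $ v) = cut_weight w e (set ys)"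
proof -
  obtain y where tight: "\<And>ys zs. xs = ys @ zs \<Longrightarrow> sum y (set ys) = cut_weight w e (set ys)"
    and le: "\<And>T. T \<subseteq> set xs \<Longrightarrow> sum y T \<le> cut_weight w e T"
    using greedy_vector_exists[of xs "cut_weight w e", OF assms(2) cut_weight_empty[OF assms(1)]
        cut_weight_submodular[OF assms(1)]] by metis
  have "sum y UNIV = 0"
    using tight[of xs "[]"] assms cut_weight_UNIV by simp
  then have "(\<chi> v. y v) \<in> base_polytope w e"
    using le assms(3) by (simp add: base_polytope_def)
  then show ?thesis using tight by (intro bexI[of _ "\<chi> v. y v"]) auto
qed

section \<open>The Lovasz extension as a support function\<close>

lemma inner_le_lovasz_ext:
  assumes "e \<in> E" and "y \<in> base_polytope w e"
  shows "y \<bullet> x \<le> lovasz_ext w e x"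
proof -
  have "bdd_above ((\<lambda>y. y \<bullet> x) ` base_polytope w e)"
    by (intro bounded_imp_bdd_above compact_imp_bounded compact_continuous_image
        compact_base_polytope assms continuous_intros)
  then show ?thesis unfolding lovasz_ext_def by (rule cSUP_upper[OF assms(2)])
qed

text \<open>Compactness and the member 0 of the polytope turn the supremum in the definition into a
  maximum.\<close>

lemma lovasz_ext_attained:
  assumes "e \<in> E"
  shows "\<exists>y\<in>base_polytope w e. y \<bullet> x = lovasz_ext w e x"
proof -
  have "continuous_on (base_polytope w e) (\<lambda>y. y \<bullet> x)" by (intro continuous_intros)
  then obtain y where y: "y \<in> base_polytope w e" "\<And>y'. y' \<in> base_polytope w e \<Longrightarrow> y' \<bullet> x \<le> y \<bullet> x"
    using continuous_attains_sup[OF compact_base_polytope[OF assms]] zero_in_base_polytope[OF assms]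
    by blast
  then have "lovasz_ext w e x \<le> y \<bullet> x"
    unfolding lovasz_ext_def by (intro cSUP_least) auto
  then show ?thesis using y(1) inner_le_lovasz_ext[OF assms y(1), of x] by force
qed

section \<open>Projection and Lagrangian duality\<close>

lemma Q1_ge_feasible:
  assumes "y \<in> l2_feasible E w \<theta>"
  shows "(\<Sum>e\<in>E. y e) \<bullet> z \<le> Q1 E w \<theta> z"
  unfolding Q1_def inner_sum_left
proof (rule sum_mono)
  fix e assume e: "e \<in> E"
  then obtain b where b: "b \<in> base_polytope w e" "y e = \<theta> e *\<^sub>R b"
    using assms by (auto simp: l2_feasible_def)
  then show "y e \<bullet> z \<le> \<theta> e * lovasz_ext w e z"
    using inner_le_lovasz_ext[OF e b(1)] edge_weight_pos[OF e] by simp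
qed

text \<open>The choices for different hyperedges are independent, so maximisers taken edge by edge
  add up to a maximiser over the Minkowski sum.\<close>

lemma Q1_attained: "\<exists>y\<in>l2_feasible E w \<theta>. (\<Sum>e\<in>E. y e) \<bullet> z = Q1 E w \<theta> z"
proof -
  obtain b where b: "\<And>e. e \<in> E \<Longrightarrow> b e \<in> base_polytope w e \<and> b e \<bullet> z = lovasz_ext w e z"
    using lovasz_ext_attained[of _ z] by metis
  then have "(\<lambda>e. \<theta> e *\<^sub>R b e) \<in> l2_feasible E w \<theta>" by (auto simp: l2_feasible_def)
  moreover have "(\<Sum>e\<in>E. \<theta> e *\<^sub>R b e) \<bullet> z = Q1 E w \<theta> z"
    unfolding Q1_def inner_sum_left using b by (intro sum.cong) auto
  ultimately show ?thesis by blast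
qed

text \<open>In this form convexity and compactness pass from the summands to the set of attainable
  sums.\<close>

lemma feasible_sums_eq:
  "(\<lambda>y. \<Sum>e\<in>E. y e) ` l2_feasible E w \<theta> = (\<Sum>e\<in>E. (\<lambda>b. \<theta> e *\<^sub>R b) ` base_polytope w e)"
  by (subst set_sum_alt) (auto simp: l2_feasible_def)

lemma convex_feasible_sums: "convex ((\<lambda>y. \<Sum>e\<in>E. y e) ` l2_feasible E w \<theta>)"
  unfolding feasible_sums_eq
  by (intro convex_set_sum convex_scaling convex_base_polytope)

lemma compact_feasible_sums: "compact ((\<lambda>y. \<Sum>e\<in>E. y e) ` l2_feasible E w \<theta>)"
proof -
  have "compact (\<Sum>e\<in>E'. (\<lambda>b. \<theta> e *\<^sub>R b) ` base_polytope w e)" if "E' \<subseteq> E" for E'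
    using finite[of E'] that
  proof (induction E' rule: finite_induct)
    case (insert e E')
    let ?C = "\<lambda>e. (\<lambda>b. \<theta> e *\<^sub>R b) ` base_polytope w e"
    have "compact {x + y |x y. x \<in> ?C e \<and> y \<in> (\<Sum>e\<in>E'. ?C e)}"
      using insert by (intro compact_sums compact_scaling compact_base_polytope) auto
    moreover have "(\<Sum>e\<in>insert e E'. ?C e) = {x + y |x y. x \<in> ?C e \<and> y \<in> (\<Sum>e\<in>E'. ?C e)}"
      using insert by (auto simp: set_plus_def)
    ultimately show ?case by simp
  qed simp
  then show ?thesis unfolding feasible_sums_eq by blast
qed

section \<open>The nearest point of the Minkowski sum and its residual\<close>

lemma l2_objective_attained: "\<exists>y. is_arg_min (l2_objective E lam g) (\<lambda>y. y \<in> l2_feasible E w \<theta>) y"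
proof -
  let ?K = "(\<lambda>y. \<Sum>e\<in>E. y e) ` l2_feasible E w \<theta>"
  \<comment> \<open>The objective sees \<open>y\<close> only through its sum over \<open>E\<close>,
    so a nearest point is found in the compact set of sums and then lifted to a feasible
    \<open>y\<close>.\<close>
  have "?K \<noteq> {}" using Q1_attained by blast
  then obtain p where "p \<in> ?K" "\<And>q. q \<in> ?K \<Longrightarrow> dist (lam *\<^sub>R g) p \<le> dist (lam *\<^sub>R g) q"
    using distance_attains_inf[OF compact_imp_closed[OF compact_feasible_sums]] by metis
  then show ?thesis
    by (fastforce simp: is_arg_min_linorder l2_objective_def dist_norm norm_minus_commute
        intro: power_mono)
qed

text \<open>The residual is normal to the set of sums at the projection, so the projection maximises
  the inner product with \<open>r\<close>. Hence \<open>Q1\<close> at the normalised residual is the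
  inner product with the projection, and subtracting the linear term leaves minus the inner product
  with \<open>r\<close>.\<close>

lemma projection_residual:
  assumes min: "is_arg_min (l2_objective E lam g) (\<lambda>y. y \<in> l2_feasible E w \<theta>) y"
  defines "r \<equiv> lam *\<^sub>R g - (\<Sum>e\<in>E. y e)"
  shows "ipm_objective E w \<theta> lam g (r /\<^sub>R norm r) = - norm r"
proof -
  let ?K = "(\<lambda>y. \<Sum>e\<in>E. y e) ` l2_feasible E w \<theta>"
  let ?p = "\<Sum>e\<in>E. y e" and ?z = "r /\<^sub>R norm r"
  have y: "y \<in> l2_feasible E w \<theta>" using min by (simp add: is_arg_min_def)
  have "norm r \<le> norm (lam *\<^sub>R g - (\<Sum>e\<in>E. y' e))" if "y' \<in> l2_feasible E w \<theta>" for y'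
    using min that unfolding is_arg_min_linorder l2_objective_def r_def
    by (metis norm_minus_commute norm_ge_zero power2_le_imp_le)
  then have dist: "\<forall>q\<in>?K. dist (lam *\<^sub>R g) ?p \<le> dist (lam *\<^sub>R g) q"
    by (auto simp: dist_norm r_def)
  \<comment> \<open>The variational inequality of a nearest point in a closed convex set.\<close>
  have normal: "r \<bullet> (q - ?p) \<le> 0" if "q \<in> ?K" for q
    unfolding r_def
    by (rule any_closest_point_dot[OF convex_feasible_sums compact_imp_closed[OF compact_feasible_sums] _ that dist])
      (use y in blast)
  obtain y' where y': "y' \<in> l2_feasible E w \<theta>" "(\<Sum>e\<in>E. y' e) \<bullet> ?z = Q1 E w \<theta> ?z"
    using Q1_attained by blast
  have "inverse (norm r) * (r \<bullet> ((\<Sum>e\<in>E. y' e) - ?p)) \<le> 0"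
    using normal y'(1) by (intro mult_nonneg_nonpos) auto
  then have "Q1 E w \<theta> ?z \<le> ?p \<bullet> ?z"
    using y'(2) by (simp add: algebra_simps inner_commute)
  then have "Q1 E w \<theta> ?z = ?p \<bullet> ?z" using Q1_ge_feasible[OF y, of ?z] by simp
  then have "ipm_objective E w \<theta> lam g ?z = - (r \<bullet> ?z)"
    unfolding ipm_objective_def inner_commute[of _ g] by (simp add: r_def inner_diff_left right_diff_distrib)
  \<comment> \<open>The case \<open>r = 0\<close> is covered because the inverse of 0 is 0, so
    \<open>?z\<close> is then 0.\<close>
  also have "r \<bullet> ?z = norm r"
    by (cases "r = 0") (simp_all add: dot_square_norm power2_eq_square)
  finally show ?thesis .
qed

section \<open>Weak duality, the saddle point and its uniqueness\<close>

lemma ipm_objective_ge_coupling: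
  assumes "y \<in> l2_feasible E w \<theta>"
  shows "- ipm_objective E w \<theta> lam g z \<le> (lam *\<^sub>R g - (\<Sum>e\<in>E. y e)) \<bullet> z"
  using Q1_ge_feasible[OF assms, of z]
  by (simp add: ipm_objective_def inner_diff_left inner_commute[of z g])

lemma coupling_le_norm:
  fixes r z :: "real ^ 'n"
  assumes "norm z \<le> 1"
  shows "r \<bullet> z \<le> norm r"
  using norm_cauchy_schwarz[of r z] mult_left_mono[OF assms, of "norm r"] by simp

text \<open>Weak duality and Cauchy--Schwarz bound the objective on the ball below by
  \<open>- norm r\<close>, which the normalised residual attains. Any other minimiser must give
  equality in Cauchy--Schwarz, and for \<open>r \<noteq> 0\<close> this fixes it.\<close>

lemma l2_minimizer_gives_solution:
  assumes min: "is_arg_min (l2_objective E lam g) (\<lambda>y. y \<in> l2_feasible E w \<theta>) y"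
  defines "r \<equiv> lam *\<^sub>R g - (\<Sum>e\<in>E. y e)"
  shows "is_arg_min (ipm_objective E w \<theta> lam g) (\<lambda>z. norm z \<le> 1) (r /\<^sub>R norm r)"
    and "is_arg_min (ipm_objective E w \<theta> lam g) (\<lambda>z. norm z \<le> 1) z \<Longrightarrow> r \<noteq> 0 \<Longrightarrow> z = r /\<^sub>R norm r"
proof -
  have y: "y \<in> l2_feasible E w \<theta>" using min by (simp add: is_arg_min_def)
  have val: "ipm_objective E w \<theta> lam g (r /\<^sub>R norm r) = - norm r"
    using projection_residual[OF min] by (simp add: r_def)
  have ge: "- ipm_objective E w \<theta> lam g z \<le> r \<bullet> z" for z
    unfolding r_def by (rule ipm_objective_ge_coupling[OF y])
  have unit: "norm (r /\<^sub>R norm r) \<le> 1" by (cases "r = 0") auto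
  show "is_arg_min (ipm_objective E w \<theta> lam g) (\<lambda>z. norm z \<le> 1) (r /\<^sub>R norm r)"
    unfolding is_arg_min_linorder using val unit ge coupling_le_norm by (smt (verit))
  assume z: "is_arg_min (ipm_objective E w \<theta> lam g) (\<lambda>z. norm z \<le> 1) z" and "r \<noteq> 0"
  have z1: "norm z \<le> 1" using z by (simp add: is_arg_min_def)
  have "ipm_objective E w \<theta> lam g z \<le> - norm r"
    using z unit val unfolding is_arg_min_linorder by metis
  then have "norm r \<le> r \<bullet> z" using ge[of z] by simp
  then have "r \<bullet> z = norm r" using coupling_le_norm[OF z1, of r] by simp
  then have "z \<bullet> (r /\<^sub>R norm r) = 1" using \<open>r \<noteq> 0\<close> by (simp add: inner_commute)
  \<comment> \<open>Expanding the squared distance with inner product 1 and a unit vector gives the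
    squared norm of \<open>z\<close> minus 1, which is at most 0.\<close>
  then have "(norm (z - r /\<^sub>R norm r))\<^sup>2 = (norm z)\<^sup>2 + (norm (r /\<^sub>R norm r))\<^sup>2 - 2"
    by (simp only: power2_norm_eq_inner inner_diff_left inner_diff_right inner_commute[of "r /\<^sub>R norm r" z])
  then have "(norm (z - r /\<^sub>R norm r))\<^sup>2 = (norm z)\<^sup>2 - 1" using \<open>r \<noteq> 0\<close> by simp
  moreover have "(norm z)\<^sup>2 \<le> 1" using z1 by (simp add: power_le_one)
  ultimately have "norm (z - r /\<^sub>R norm r) = 0"
    by (smt (verit) zero_le_power2 power_eq_0_iff)
  then show "z = r /\<^sub>R norm r" by simp
qed

text \<open>Maximising the coupling over the unit ball produces the unsquared norm of the residual;
  hence \<open>sqrt\<close>, which leaves the minimisers unchanged. Minimising it over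
  \<open>y\<close> produces \<open>Q1\<close>, a support function. The projection and its normalised
  residual close the gap.\<close>

lemma ipm_l2_duality:
  "minimax_dual (\<lambda>y z. (lam *\<^sub>R g - (\<Sum>e\<in>E. y e)) \<bullet> z)
     (l2_feasible E w \<theta>) (\<lambda>y. sqrt (l2_objective E lam g y))
     {z. norm z \<le> 1} (\<lambda>z. - ipm_objective E w \<theta> lam g z)"
  unfolding minimax_dual_def
proof (intro conjI ballI)
  have sqrt_eq: "sqrt (l2_objective E lam g y) = norm (lam *\<^sub>R g - (\<Sum>e\<in>E. y e))" for y
    by (simp add: l2_objective_def norm_minus_commute)
  fix y
  let ?r = "lam *\<^sub>R g - (\<Sum>e\<in>E. y e)"
  have "?r \<bullet> (?r /\<^sub>R norm ?r) = norm ?r"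
    by (cases "?r = 0") (simp_all add: dot_square_norm power2_eq_square)
  moreover have "norm (?r /\<^sub>R norm ?r) \<le> 1" by (cases "?r = 0") auto
  ultimately show "\<exists>z. is_arg_max (\<lambda>z. ?r \<bullet> z) (\<lambda>z. z \<in> {z. norm z \<le> 1}) z \<and>
      sqrt (l2_objective E lam g y) = ?r \<bullet> z"
    using coupling_le_norm[of _ ?r]
    by (intro exI[of _ "?r /\<^sub>R norm ?r"]) (auto simp: is_arg_max_linorder sqrt_eq)
next
  fix z :: "real ^ 'n"
  obtain y where y: "y \<in> l2_feasible E w \<theta>" "(\<Sum>e\<in>E. y e) \<bullet> z = Q1 E w \<theta> z"
    using Q1_attained by blast
  then have "- ipm_objective E w \<theta> lam g z = (lam *\<^sub>R g - (\<Sum>e\<in>E. y e)) \<bullet> z"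
    by (simp add: ipm_objective_def inner_diff_left inner_commute[of z g])
  then show "\<exists>y. is_arg_min (\<lambda>y. (lam *\<^sub>R g - (\<Sum>e\<in>E. y e)) \<bullet> z) (\<lambda>y. y \<in> l2_feasible E w \<theta>) y \<and>
      - ipm_objective E w \<theta> lam g z = (lam *\<^sub>R g - (\<Sum>e\<in>E. y e)) \<bullet> z"
    using y(1) ipm_objective_ge_coupling[of _ lam g z]
    by (intro exI[of _ y]) (auto simp: is_arg_min_linorder)
next
  obtain y where y: "is_arg_min (l2_objective E lam g) (\<lambda>y. y \<in> l2_feasible E w \<theta>) y"
    using l2_objective_attained by blast
  let ?r = "lam *\<^sub>R g - (\<Sum>e\<in>E. y e)"
  have "is_arg_min (\<lambda>y. sqrt (l2_objective E lam g y)) (\<lambda>y. y \<in> l2_feasible E w \<theta>) y"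
    using y by (simp add: is_arg_min_linorder)
  moreover have "is_arg_max (\<lambda>z. - ipm_objective E w \<theta> lam g z) (\<lambda>z. z \<in> {z. norm z \<le> 1}) (?r /\<^sub>R norm ?r)"
    using l2_minimizer_gives_solution(1)[OF y] by (simp add: is_arg_min_linorder is_arg_max_linorder)
  moreover have "sqrt (l2_objective E lam g y) = - ipm_objective E w \<theta> lam g (?r /\<^sub>R norm ?r)"
    using projection_residual[OF y] by (simp add: l2_objective_def norm_minus_commute)
  ultimately show "\<exists>y z. is_arg_min (\<lambda>y. sqrt (l2_objective E lam g y)) (\<lambda>y. y \<in> l2_feasible E w \<theta>) y \<and>
      is_arg_max (\<lambda>z. - ipm_objective E w \<theta> lam g z) (\<lambda>z. z \<in> {z. norm z \<le> 1}) z \<and>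
      sqrt (l2_objective E lam g y) = - ipm_objective E w \<theta> lam g z"
    by blast
qed

section \<open>Submodular minimization\<close>

text \<open>The sign vector is twice the indicator of \<open>S\<close> minus the all-ones vector,
  and the latter is orthogonal to every base polytope. What remains is the maximum of the sum of
  \<open>y\<close> over \<open>S\<close>, whose bound by the cut weight is tight for a greedy
  vector.\<close>

lemma Q1_sign_vector: "Q1 E w \<theta> (sign_vector S) = 2 * (\<Sum>e\<in>E. \<theta> e * cut_weight w e S)"
proof -
  have "lovasz_ext w e (sign_vector S) = 2 * cut_weight w e S" if e: "e \<in> E" for e
  proof -
    have eq: "y \<bullet> sign_vector S = 2 * (\<Sum>v\<in>S. y $ v)" if "y \<in> base_polytope w e" for y
    proof -
      have "y \<bullet> sign_vector S = (\<Sum>v\<in>UNIV. 2 * (if v \<in> S then y $ v else 0) - y $ v)"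
        unfolding inner_vec_def by (intro sum.cong) (auto simp: sign_vector_def)
      also have "\<dots> = 2 * (\<Sum>v\<in>S. y $ v)"
        using that
        by (simp add: sum_subtractf sum_distrib_left[symmetric] base_polytope_def sum.If_cases)
      finally show ?thesis .
    qed
    \<comment> \<open>Listing \<open>S\<close> first makes it a prefix, where the greedy vector is
      tight.\<close>
    obtain ys zs where "set ys = S" "distinct ys" "set zs = - S" "distinct zs"
      using finite_distinct_list finite by metis
    then have "distinct (ys @ zs)" "set (ys @ zs) = UNIV" "set ys = S" by auto
    then obtain y where y: "y \<in> base_polytope w e" "(\<Sum>v\<in>S. y $ v) = cut_weight w e S"
      using greedy_in_base_polytope[OF e] by metis
    obtain y' where y': "y' \<in> base_polytope w e" "y' \<bullet> sign_vector S = lovasz_ext w e (sign_vector S)"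
      using lovasz_ext_attained[OF e] by blast
    have "(\<Sum>v\<in>S. y' $ v) \<le> cut_weight w e S" using y'(1) by (simp add: base_polytope_def)
    then show ?thesis
      using inner_le_lovasz_ext[OF e y(1), of "sign_vector S"] y y' eq by simp
  qed
  then show ?thesis unfolding Q1_def by (simp add: sum_distrib_left algebra_simps)
qed

text \<open>The zero sum of \<open>g\<close> removes the all-ones part from the linear term just as
  it is removed from \<open>Q1\<close>, so both terms carry the same factor 2.\<close>

lemma ipm_objective_sign_vector:
  assumes "(\<Sum>v\<in>UNIV. g $ v) = 0"
  shows "ipm_objective E w \<theta> lam g (sign_vector S) = 2 * sfm_objective E w \<theta> lam g S"
proof -
  have "sign_vector S \<bullet> g = (\<Sum>v\<in>UNIV. 2 * (if v \<in> S then g $ v else 0) - g $ v)"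
    unfolding inner_vec_def by (intro sum.cong) (auto simp: sign_vector_def)
  also have "\<dots> = 2 * (\<Sum>v\<in>S. g $ v)"
    using assms by (simp add: sum_subtractf sum_distrib_left[symmetric] sum.If_cases)
  finally show ?thesis
    by (simp add: ipm_objective_def sfm_objective_def Q1_sign_vector algebra_simps)
qed

text \<open>A single vertex order serves all hyperedges, so their greedy vectors are tight on the
  same prefixes and can be added.\<close>

lemma ipm_objective_ge_sfm:
  assumes g: "(\<Sum>v\<in>UNIV. g $ v) = 0" and z: "infnorm z \<le> 1"
    and m: "\<And>S. m \<le> sfm_objective E w \<theta> lam g S"
  shows "2 * m \<le> ipm_objective E w \<theta> lam g z"
proof -
  obtain xs0 :: "'n list" where xs0: "set xs0 = UNIV" "distinct xs0"
    using finite_distinct_list finite by metis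
  define xs where "xs = sort_key (\<lambda>v. - (z $ v)) xs0"
  have xs: "set xs = UNIV" "distinct xs" using xs0 by (simp_all add: xs_def)
  have "sorted (map (\<lambda>v. - (z $ v)) xs)" by (simp add: xs_def)
  then have sorted: "sorted_wrt (\<lambda>u v. z $ v \<le> z $ u) xs" by (simp add: sorted_wrt_map)
  obtain b where b: "\<And>e. e \<in> E \<Longrightarrow> b e \<in> base_polytope w e"
    and tight: "\<And>e ys zs. e \<in> E \<Longrightarrow> xs = ys @ zs \<Longrightarrow>
           (\<Sum>v\<in>set ys. b e $ v) = cut_weight w e (set ys)"
    using greedy_in_base_polytope[OF _ xs(2,1)] by metis
  \<comment> \<open>The linear function given by \<open>Y\<close> lies below the objective, while
    its sums over prefixes are exactly values of the set function.\<close>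
  define Y where "Y = (\<Sum>e\<in>E. \<theta> e *\<^sub>R b e) - lam *\<^sub>R g"
  have Y_sum: "(\<Sum>v\<in>S. Y $ v) = (\<Sum>e\<in>E. \<theta> e * (\<Sum>v\<in>S. b e $ v)) - lam * (\<Sum>v\<in>S. g $ v)" for S
    unfolding Y_def
    by (simp add: sum_subtractf sum_distrib_left) (rule sum.swap)
  have prefix: "m \<le> (\<Sum>v\<in>set ys. Y $ v)" if "xs = ys @ zs" for ys zs
    using m[of "set ys"] tight[OF _ that] by (simp add: Y_sum sfm_objective_def)
  have "(\<Sum>v\<in>UNIV. Y $ v) = 0"
    using b g by (simp add: Y_sum base_polytope_def)
  have comp: "\<bar>z $ v\<bar> \<le> 1" for v
    using component_le_infnorm_cart[of z v] z by simp
  \<comment> \<open>The entries of \<open>z\<close> lie between -1 and 1; the length of this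
    interval is the factor 2. The shift by -1 costs nothing because \<open>Y\<close> sums to
    0.\<close>
  have "m * (1 - (- 1)) \<le> (\<Sum>v\<in>set xs. Y $ v * (z $ v - (- 1)))"
    using comp by (intro sum_mult_ge_of_prefix_sums_ge xs sorted prefix) (auto simp: abs_le_iff minus_le_iff)
  also have "\<dots> = Y \<bullet> z"
    using \<open>(\<Sum>v\<in>UNIV. Y $ v) = 0\<close>
    by (simp add: xs inner_vec_def algebra_simps sum.distrib)
  also have "Y \<bullet> z = (\<Sum>e\<in>E. \<theta> e *\<^sub>R b e) \<bullet> z - lam * (z \<bullet> g)"
    by (simp add: Y_def inner_diff_left inner_commute[of z g])
  also have "\<dots> \<le> ipm_objective E w \<theta> lam g z"
    unfolding ipm_objective_def
    by (intro diff_right_mono Q1_ge_feasible) (use b in \<open>auto simp: l2_feasible_def\<close>)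
  finally show ?thesis by simp
qed

lemma infnorm_sign_vector: "infnorm (sign_vector S :: real ^ 'n) \<le> 1"
  unfolding infnorm_cart by (rule cSup_least) (auto simp: sign_vector_def)

text \<open>Twice the least set value bounds the objective below on the whole ball, and the sign
  vector of a minimising set attains it. Thus sign vectors suffice for the minimum, although other
  points of the ball may attain it too.\<close>

lemma ipm_sfm_equivalence:
  assumes g: "(\<Sum>v\<in>UNIV. g $ v) = 0"
  shows "(INF z\<in>{z. infnorm z \<le> 1}. ipm_objective E w \<theta> lam g z)
           = 2 * Min (range (sfm_objective E w \<theta> lam g))"
    and "is_arg_min (sfm_objective E w \<theta> lam g) (\<lambda>_. True) S \<longleftrightarrow>
         is_arg_min (ipm_objective E w \<theta> lam g) (\<lambda>z. infnorm z \<le> 1) (sign_vector S)"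
proof -
  let ?f = "sfm_objective E w \<theta> lam g" and ?h = "ipm_objective E w \<theta> lam g"
  have fin: "finite (range ?f)" by simp
  obtain T where T: "?f T = Min (range ?f)" using Min_in[OF fin] by (auto simp: image_iff)
  have h_sign: "?h (sign_vector S) = 2 * ?f S" for S
    by (rule ipm_objective_sign_vector[OF g])
  show "(INF z\<in>{z. infnorm z \<le> 1}. ?h z) = 2 * Min (range ?f)"
  proof (rule cInf_eq_minimum)
    show "2 * Min (range ?f) \<in> ?h ` {z. infnorm z \<le> 1}"
      using h_sign[of T] T infnorm_sign_vector by (intro image_eqI[of _ _ "sign_vector T"]) auto
  qed (use ipm_objective_ge_sfm[OF g] Min_le[OF fin] in auto)
  show "is_arg_min ?f (\<lambda>_. True) S \<longleftrightarrow> is_arg_min ?h (\<lambda>z. infnorm z \<le> 1) (sign_vector S)"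
  proof
    assume "is_arg_min ?f (\<lambda>_. True) S"
    then show "is_arg_min ?h (\<lambda>z. infnorm z \<le> 1) (sign_vector S)"
      using ipm_objective_ge_sfm[OF g] by (auto simp: is_arg_min_linorder h_sign infnorm_sign_vector)
  next
    assume "is_arg_min ?h (\<lambda>z. infnorm z \<le> 1) (sign_vector S)"
    then have "2 * ?f S \<le> 2 * ?f T" for T
      using infnorm_sign_vector[of T] h_sign unfolding is_arg_min_linorder by metis
    then show "is_arg_min ?f (\<lambda>_. True) S" by (simp add: is_arg_min_linorder)
  qed
qed

end

section \<open>Weighted medians\<close>

text \<open>While the shift \<open>c\<close> stays too small to change the sign of an entry, the
  weighted norm is affine in \<open>c\<close> with slope minus the signed weight. A minimum at the
  interior point 0 forces slope 0.\<close>

lemma weighted_median_balanced: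
  fixes x :: "real ^ 'n::finite"
  assumes min: "\<And>c. l1_norm \<mu> x \<le> l1_norm \<mu> (x - vec c)" and nz: "\<And>v. x $ v \<noteq> 0"
  shows "(\<Sum>v\<in>UNIV. sgn (x $ v) * \<mu> v) = 0"
proof -
  define d where "d = Min (range (\<lambda>v. \<bar>x $ v\<bar>))"
  have d_le: "d \<le> \<bar>x $ v\<bar>" for v unfolding d_def by (rule Min_le) auto
  have d_pos: "d > 0" using nz unfolding d_def by (subst Min_gr_iff) auto
  have "l1_norm \<mu> (x - vec c) = l1_norm \<mu> x - c * (\<Sum>v\<in>UNIV. sgn (x $ v) * \<mu> v)"
    if "\<bar>c\<bar> \<le> d" for c
  proof -
    have "\<bar>x $ v - c\<bar> = \<bar>x $ v\<bar> - c * sgn (x $ v)" for v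
      using that d_le[of v] nz[of v] by (auto simp: sgn_if abs_if split: if_splits)
    then have "l1_norm \<mu> (x - vec c) = (\<Sum>v\<in>UNIV. \<mu> v * (\<bar>x $ v\<bar> - c * sgn (x $ v)))"
      by (simp add: l1_norm_def)
    then show ?thesis
      by (simp add: l1_norm_def algebra_simps sum_subtractf sum_distrib_left)
  qed
  \<comment> \<open>The shifts \<open>d\<close> and \<open>- d\<close> give the two opposite
    inequalities for the slope.\<close>
  from this[of d] this[of "- d"] min[of d] min[of "- d"] d_pos
  show ?thesis by (simp add: mult_le_0_iff zero_le_mult_iff)
qed

text \<open>If \<open>x\<close> has zero entries, their values in \<open>ipm_g\<close> are chosen to
  cancel the surplus of positive over negative weight. Otherwise nothing is left to compensate, and
  the median condition itself provides the balance.\<close>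

lemma sum_ipm_g_eq_0:
  fixes x :: "real ^ 'n::finite"
  assumes pos: "\<And>v. \<mu> v > 0" and min: "\<And>c. l1_norm \<mu> x \<le> l1_norm \<mu> (x - vec c)"
  shows "(\<Sum>v\<in>UNIV. ipm_g \<mu> x $ v) = 0"
proof (cases "\<exists>v. x $ v = 0")
  case False
  then show ?thesis using weighted_median_balanced[OF min] by (simp add: ipm_g_def)
next
  case True
  define q where "q = (mu_plus \<mu> x - mu_minus \<mu> x) / mu_zero \<mu> x"
  have "mu_zero \<mu> x > 0" unfolding mu_zero_def using True pos by (intro sum_pos) auto
  have "(\<Sum>v\<in>UNIV. ipm_g \<mu> x $ v) =
      (\<Sum>v\<in>UNIV. (if x $ v > 0 then \<mu> v else 0) - (if x $ v < 0 then \<mu> v else 0)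
              - q * (if x $ v = 0 then \<mu> v else 0))"
    by (intro sum.cong) (auto simp: ipm_g_def sgn_if q_def)
  also have "\<dots> = mu_plus \<mu> x - mu_minus \<mu> x - q * mu_zero \<mu> x"
    by (simp add: sum_subtractf sum_distrib_left[symmetric] sum.If_cases mu_plus_def mu_minus_def
        mu_zero_def)
  finally show ?thesis using \<open>mu_zero \<mu> x > 0\<close> by (simp add: q_def)
qed

text \<open>Every later iterate has been shifted by its own weighted median, which moves that median
  to 0; the initial vector is chosen with this property.\<close>

lemma ipm_state_weighted_median:
  assumes "ipm_state E w \<theta> \<mu> nrm \<epsilon> k x lam"
  shows "l1_norm \<mu> x \<le> l1_norm \<mu> (x - vec c)"
  using assms
proof cases
  case init
  then show ?thesis by (force simp: is_arg_min_linorder)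
next
  case (step k x0 lam0 z c')
  have "z - vec c' - vec c = z - vec (c' + c)" by (simp add: vec_eq_iff)
  then show ?thesis using step(4,5) by (simp only: is_arg_min_linorder)
qed

text \<open>The uniqueness clause is guarded by \<open>r \<noteq> 0\<close>: a zero residual makes
  the optimal value 0, which every constant vector in the ball attains, since the base polytopes and
  \<open>g\<close> have zero sum.\<close>

theorem theorem4p7:
  fixes E :: "'n::finite set set"
    and w :: "'n set \<Rightarrow> 'n set \<Rightarrow> real"
    and \<theta> :: "'n set \<Rightarrow> real"
    and \<mu> :: "'n \<Rightarrow> real"
    and \<epsilon> :: real
  assumes "submodular_hypergraph E w \<theta> \<mu>"
  shows
    "(\<forall>k x lam g.
        ipm_state E w \<theta> \<mu> norm \<epsilon> k x lam \<and> g = ipm_g \<mu> x \<longrightarrow>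
        minimax_dual
          (\<lambda>y z. (lam *\<^sub>R g - (\<Sum>e\<in>E. y e)) \<bullet> z)
          (l2_feasible E w \<theta>) (\<lambda>y. sqrt (l2_objective E lam g y))
          {z. norm z \<le> 1} (\<lambda>z. - ipm_objective E w \<theta> lam g z) \<and>
        (\<forall>y r. is_arg_min (l2_objective E lam g) (\<lambda>y. y \<in> l2_feasible E w \<theta>) y \<and>
               r = lam *\<^sub>R g - (\<Sum>e\<in>E. y e) \<longrightarrow>
               is_arg_min (ipm_objective E w \<theta> lam g) (\<lambda>z. norm z \<le> 1) (r /\<^sub>R norm r) \<and>
               (r \<noteq> 0 \<longrightarrow>
                  (\<forall>z. is_arg_min (ipm_objective E w \<theta> lam g) (\<lambda>z. norm z \<le> 1) z \<longrightarrow>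
                       z = r /\<^sub>R norm r))))
     \<and>
     (\<forall>k x lam g.
        ipm_state E w \<theta> \<mu> infnorm \<epsilon> k x lam \<and> g = ipm_g \<mu> x \<longrightarrow>
        (INF z\<in>{z. infnorm z \<le> 1}. ipm_objective E w \<theta> lam g z)
          = 2 * Min (range (sfm_objective E w \<theta> lam g)) \<and>
        (\<forall>S. ipm_objective E w \<theta> lam g (sign_vector S) = 2 * sfm_objective E w \<theta> lam g S) \<and>
        (\<forall>S. is_arg_min (sfm_objective E w \<theta> lam g) (\<lambda>_. True) S \<longleftrightarrow>
             is_arg_min (ipm_objective E w \<theta> lam g) (\<lambda>z. infnorm z \<le> 1) (sign_vector S)))"
proof -
  interpret submodular_hypergraph E w \<theta> \<mu> by (rule assms)
  \<comment> \<open>This is where the run enters the maximum norm part: its iterates have weighted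
    median 0, so \<open>g\<close> has zero sum.\<close>
  have "(\<Sum>v\<in>UNIV. ipm_g \<mu> x $ v) = 0" if "ipm_state E w \<theta> \<mu> infnorm \<epsilon> k x lam" for k x lam
    by (rule sum_ipm_g_eq_0[OF vertex_weight_pos ipm_state_weighted_median[OF that]])
  then show ?thesis
    using ipm_l2_duality l2_minimizer_gives_solution ipm_sfm_equivalence ipm_objective_sign_vector
    by (intro conjI allI impI; (elim conjE)?) (auto simp only: simp_thms)
qed

end
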